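(* Let $\mathcal U,\mathcal V,\mathcal W$ denote arbitrary sets. The conditional infimum has the following properties. 1. (Nonnegativity) For any function $f:\mathcal U\to\overline{\mathbb R}$ and any correspondence $\mathcal R$ between $\mathcal U$ and $\mathcal V$: $\mathrm{Inf}[f\mid\mathcal R]\ge 0$ if and only if ($u\in\mathrm{dom}\,\mathcal R\implies f(u)\ge 0$). 2. (Strict epigraph) For any $f:\mathcal U\to\overline{\mathbb R}$ and any correspondence $\mathcal R$ between $\mathcal U$ and $\mathcal V$: $\mathrm{epi}_s\,\mathrm{Inf}[f\mid\mathcal R]=\mathcal R^{-1}(\mathrm{epi}_s f)$, where the right-hand side is the composition of the correspondence $\mathcal R^{-1}$ between $\mathcal V$ and $\mathcal U$ with $\mathrm{epi}_s f\subset\mathcal U\times\mathbb R$ viewed as a correspondence between $\mathcal U$ and $\mathbb R$. 3. ($\wedge$ and $\vee$) For any correspondence $\mathcal R$ between $\mathcal U$ and $\mathcal V$ and any family $(f_i)_{i\in I}$ of functions $f_i:\mathcal U\to\overline{\mathbb R}$: $\mathrm{Inf}[\bigwedge_{i\in I}f_i\mid\mathcal R]=\bigwedge_{i\in I}\mathrm{Inf}[f_i\mid\mathcal R]$ and $\bigvee_{i\in I}\mathrm{Inf}[f_i\mid\mathcal R]\le\mathrm{Inf}[\bigvee_{i\in I}f_i\mid\mathcal R]$. 4. (Upper addition) For any correspondence $\mathcal R$ between $\mathcal U$ and $\mathcal V$ and any functions $f,g:\mathcal U\to\overline{\mathbb R}$: $\mathrm{Inf}[f\dotplus g\mid\mathcal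 R]\ge\mathrm{Inf}[f\mid\mathcal R]\dotplus\mathrm{Inf}[g\mid\mathcal R]$; and if the function $g$ is constant on any foreset $\mathcal R v$, for any $v\in\mathcal V$ (or, equivalently, if $\mathrm{argminInf}[g\mid\mathcal R](v)=\mathcal R v$ for all $v\in\mathcal V$; or, equivalently, if $\mathrm{Inf}[g\mid\mathcal R]=\mathrm{Sup}[g\mid\mathcal R]$), then $\mathrm{Inf}[f\dotplus g\mid\mathcal R]=\mathrm{Inf}[f\mid\mathcal R]\dotplus\mathrm{Inf}[g\mid\mathcal R]$. 5. (Monotonicity in functions) For any correspondence $\mathcal R$ between $\mathcal U$ and $\mathcal V$ and any $f,g:\mathcal U\to\overline{\mathbb R}$: $f\le g\implies\mathrm{Inf}[f\mid\mathcal R]\le\mathrm{Inf}[g\mid\mathcal R]$; moreover $\inf_{\mathcal U}f\le\inf_{\mathcal R\mathcal V}f\le\mathrm{Inf}[f\mid\mathcal R](v)$ for all $v\in\mathcal V$; and for any nondecreasing $\varphi:\overline{\mathbb R}\to\overline{\mathbb R}$, $\varphi\circ\mathrm{Inf}[f\mid\mathcal R]\le\mathrm{Inf}[\varphi\circ f\mid\mathcal R]$. 6. (Monotonicity in correspondences) For any correspondences $\mathcal R,\mathcal S$ between $\mathcal U$ and $\mathcal V$ and any $f:\mathcal U\to\overline{\mathbb R}$: $\mathcal R\subset\mathcal S\implies\mathrm{Inf}[f\mid\mathcal R]\ge\mathrm{Inf}[f\mid\mathcal S]$. 7. (Families of correspondences) For any family $(\mathcal R_i)_{i\in I}$ of correspondences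 between $\mathcal U$ and $\mathcal V$ and any $f:\mathcal U\to\overline{\mathbb R}$: $\mathrm{Inf}[f\mid\bigcup_{i\in I}\mathcal R_i]=\bigwedge_{i\in I}\mathrm{Inf}[f\mid\mathcal R_i]$ and $\mathrm{Inf}[f\mid\bigcap_{i\in I}\mathcal R_i]\ge\bigvee_{i\in I}\mathrm{Inf}[f\mid\mathcal R_i]$. 8. (Pushforward) For any correspondence $\mathcal R$ between $\mathcal U$ and $\mathcal V$, any subset $V\subset\mathcal V$ and any $f:\mathcal U\to\overline{\mathbb R}$: $\inf_{v\in V}\mathrm{Inf}[f\mid\mathcal R](v)=\inf_{u\in\mathcal RV}f(u)$. 9. (Tower property) For any correspondence $\mathcal R$ between $\mathcal U$ and $\mathcal V$, any correspondence $\mathcal S$ between $\mathcal V$ and $\mathcal W$, and any $f:\mathcal U\to\overline{\mathbb R}$: $\mathrm{Inf}\big[\mathrm{Inf}[f\mid\mathcal R]\,\big|\,\mathcal S\big]=\mathrm{Inf}[f\mid\mathcal R\mathcal S]$. 10. (Right composition with mappings) For any correspondence $\mathcal R$ between $\mathcal U$ and $\mathcal V$: for any $g:\mathcal W\to\overline{\mathbb R}$ and any mapping $\theta:\mathcal U\to\mathcal W$, $\mathrm{Inf}[g\circ\theta\mid\mathcal R]=\mathrm{Inf}[g\mid\mathcal G_\theta^{-1}\mathcal R]$; and for any $f:\mathcal U\to\overline{\mathbb R}$ and any mapping $\theta:\mathcal W\to\mathcal V$, $\mathrm{Inf}[f\mid\mathcal R]\circ\theta=\mathrm{Inf}[f\mid\mathcal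 R\,\mathcal G_\theta^{-1}]$.
   Context: $\overline{\mathbb R}=[-\infty,+\infty]$; $\inf_\emptyset f=+\infty$ and $\sup_\emptyset f=-\infty$. The upper addition $\dotplus$ extends the usual addition to $\overline{\mathbb R}$ with $(+\infty)\dotplus(-\infty)=(-\infty)\dotplus(+\infty)=+\infty$. The symbols $\bigwedge,\bigvee$ denote pointwise infimum and supremum of functions. A correspondence $\mathcal R$ between two sets $\mathcal U$ and $\mathcal V$ is a subset $\mathcal R\subset\mathcal U\times\mathcal V$; $u\mathcal Rv$ means $(u,v)\in\mathcal R$. Foresets: $\mathcal Rv=\{u\in\mathcal U: u\mathcal Rv\}$ for $v\in\mathcal V$ and $\mathcal RV=\{u\in\mathcal U:\exists v\in V,\ u\mathcal Rv\}$ for $V\subset\mathcal V$. Inverse: $\mathcal R^{-1}=\{(v,u): u\mathcal Rv\}\subset\mathcal V\times\mathcal U$. Domain: $\mathrm{dom}\,\mathcal R=\{u:\exists v,\ u\mathcal Rv\}$. Composition of $\mathcal R\subset\mathcal U\times\mathcal V$ and $\mathcal S\subset\mathcal V\times\mathcal W$: $\mathcal R\mathcal S=\{(u,w):\exists v\in\mathcal V,\ u\mathcal Rv\text{ and }v\mathcal Sw\}\subset\mathcal U\times\mathcal W$. The graph of a mapping $\theta:\mathcal A\to\mathcal B$ is the correspondence $\mathcal G_\theta=\{(a,b)\in\mathcal A\times\mathcal B:\theta(a)=b\}$. For $f:\mathcal U\to\overline{\mathbb R}$ and a correspondence $\mathcal R$ between $\mathcal U$ and $\mathcal V$, the conditional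 infimum and supremum are the functions $\mathcal V\to\overline{\mathbb R}$ given by $\mathrm{Inf}[f\mid\mathcal R](v)=\inf_{u\in\mathcal Rv}f(u)$ and $\mathrm{Sup}[f\mid\mathcal R](v)=\sup_{u\in\mathcal Rv}f(u)$. The conditional argmin is $\mathrm{argminInf}[f\mid\mathcal R](v)=\{u\in\mathcal Rv: f(u)=\inf_{u'\in\mathcal Rv}f(u')\}$. The strict epigraph of $f$ is $\mathrm{epi}_s f=\{(u,t)\in\mathcal U\times\mathbb R: f(u)<t\}$.
   Formalization: In item 4, the equivalence of constancy on foresets with Inf[g|R] = Sup[g|R] is stated only over nonempty foresets, since on an empty foreset Inf = +∞ and Sup = −∞ while constancy holds vacuously; each condition is still shown to imply the equality. *)

theory Defs
  imports "HOL-Analysis.Analysis"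
begin

text \<open>
  The sets of the theory are carrier sets, so that they may be empty. A function on a carrier
  \<open>U\<close> is a total function whose values outside \<open>U\<close> are irrelevant, and two functions
  on \<open>U\<close> are compared on \<open>U\<close> only. A correspondence between \<open>U\<close> and \<open>V\<close>
  is a relation \<open>R \<subseteq> U \<times> V\<close>; its inverse, domain, composition and foresets of sets are
  \<open>R\<inverse>\<close>, \<open>Domain R\<close>, \<open>R O S\<close> and \<open>R\<inverse> `` A\<close>.

  On \<^typ>\<open>ereal\<close>, the library's \<open>+\<close> is the upper addition: it satisfies
  \<open>\<infinity> + - \<infinity> = - \<infinity> + \<infinity> = \<infinity>\<close>, as recalled below. The infimum of the empty set
  is \<open>\<infinity>\<close> and its supremum is \<open>- \<infinity>\<close>. Infima and suprema of families of
  functions are taken in the complete lattice of functions, hence pointwise.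
\<close>

lemma ereal_plus_upper:
  "(\<infinity>::ereal) + - \<infinity> = \<infinity>" "- \<infinity> + (\<infinity>::ereal) = \<infinity>"
  by simp_all

definition foreset :: "('u \<times> 'v) set \<Rightarrow> 'v \<Rightarrow> 'u set" where
  "foreset R v = {u. (u, v) \<in> R}"

definition graph_on :: "'a set \<Rightarrow> 'b set \<Rightarrow> ('a \<Rightarrow> 'b) \<Rightarrow> ('a \<times> 'b) set" where
  "graph_on A B \<theta> = {(a, b). a \<in> A \<and> b \<in> B \<and> \<theta> a = b}"

definition cond_Inf :: "('u \<Rightarrow> ereal) \<Rightarrow> ('u \<times> 'v) set \<Rightarrow> 'v \<Rightarrow> ereal" where
  "cond_Inf f R v = (INF u\<in>foreset R v. f u)"

definition cond_Sup :: "('u \<Rightarrow> ereal) \<Rightarrow> ('u \<times> 'v) set \<Rightarrow> 'v \<Rightarrow> ereal" where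
  "cond_Sup f R v = (SUP u\<in>foreset R v. f u)"

definition cond_argmin :: "('u \<Rightarrow> ereal) \<Rightarrow> ('u \<times> 'v) set \<Rightarrow> 'v \<Rightarrow> 'u set" where
  "cond_argmin f R v = {u \<in> foreset R v. f u = (INF u'\<in>foreset R v. f u')}"

definition strict_epi :: "'u set \<Rightarrow> ('u \<Rightarrow> ereal) \<Rightarrow> ('u \<times> real) set" where
  "strict_epi U f = {(u, t). u \<in> U \<and> f u < ereal t}"

end

theory Submission
  imports Defs
begin

text \<open>
  A conditional infimum is determined by its lower bounds: \<open>x \<le> cond_Inf f R v\<close> says that \<open>x\<close>
  bounds \<open>f\<close> from below on the foreset of \<open>v\<close>. Most of the identities thus only permute universal
  quantifiers. The exception is additivity, which needs the infimum over a nonempty set to commute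
  with the upper addition of a constant, infinite constants included.
\<close>

lemma le_cond_Inf_iff: "x \<le> cond_Inf f R v \<longleftrightarrow> (\<forall>u. (u, v) \<in> R \<longrightarrow> x \<le> f u)"
  by (auto simp: cond_Inf_def foreset_def le_INF_iff)

lemma cond_Inf_lower: "(u, v) \<in> R \<Longrightarrow> cond_Inf f R v \<le> f u"
  by (simp add: cond_Inf_def foreset_def INF_lower)

lemma cond_Inf_less_iff: "cond_Inf f R v < x \<longleftrightarrow> (\<exists>u. (u, v) \<in> R \<and> f u < x)"
  by (auto simp: cond_Inf_def foreset_def INF_less_iff)

text \<open>Reduces an equation between infima to the equivalence of their lower bounds, where
  \<open>le_cond_Inf_iff\<close> and \<open>le_INF_iff\<close> leave only quantifiers.\<close>

lemma eq_by_lower_bounds: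
  fixes a b :: "'a :: order"
  assumes "\<And>x. x \<le> a \<longleftrightarrow> x \<le> b"
  shows "a = b"
  using assms[of a] assms[of b] by (intro order.antisym) simp_all

lemma cond_Inf_nonneg_iff:
  assumes "R \<subseteq> U \<times> V"
  shows "(\<forall>v\<in>V. cond_Inf f R v \<ge> 0) \<longleftrightarrow> (\<forall>u\<in>U. u \<in> Domain R \<longrightarrow> f u \<ge> 0)"
  using assms by (auto simp: le_cond_Inf_iff)

lemma strict_epi_cond_Inf:
  assumes "R \<subseteq> U \<times> V"
  shows "strict_epi V (cond_Inf f R) = R\<inverse> O strict_epi U f"
  using assms by (auto simp: strict_epi_def cond_Inf_less_iff)

lemma cond_Inf_INF: "cond_Inf (INF i\<in>I. f i) R v = (INF i\<in>I. cond_Inf (f i) R) v"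
  by (rule eq_by_lower_bounds) (auto simp: le_cond_Inf_iff le_INF_iff)

lemma SUP_cond_Inf_le: "(SUP i\<in>I. cond_Inf (f i) R) v \<le> cond_Inf (SUP i\<in>I. f i) R v"
  by (auto simp: le_cond_Inf_iff intro!: SUP_mono intro: cond_Inf_lower)

lemma cond_Inf_add_ge: "cond_Inf f R v + cond_Inf g R v \<le> cond_Inf (\<lambda>u. f u + g u) R v"
  by (auto simp: le_cond_Inf_iff intro!: add_mono cond_Inf_lower)

text \<open>Upper addition makes this hold for every constant: for \<open>c = - \<infinity>\<close> both sides are
  \<open>\<infinity>\<close> when \<open>f\<close> is \<open>\<infinity>\<close> on \<open>A\<close>, and \<open>- \<infinity>\<close> otherwise.\<close>

lemma INF_ereal_add_const:
  fixes f :: "'a \<Rightarrow> ereal"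
  assumes "A \<noteq> {}"
  shows "(INF u\<in>A. f u + c) = (INF u\<in>A. f u) + c"
proof (cases c)
  case (real r)
  show ?thesis
  proof (rule eq_by_lower_bounds)
    \<comment> \<open>For finite \<open>c\<close>, adding \<open>c\<close> and subtracting
      \<open>c\<close> are adjoint, so a lower bound can be shifted past the infimum.\<close>
    have "x \<le> y + c \<longleftrightarrow> x - c \<le> y" for x y :: ereal
      using real by (simp add: ereal_minus_le)
    then show "x \<le> (INF u\<in>A. f u + c) \<longleftrightarrow> x \<le> (INF u\<in>A. f u) + c" for x
      by (simp add: le_INF_iff)
  qed
next
  case PInf
  then show ?thesis
    using assms by simp
next
  case MInf
  show ?thesis
  proof (cases "\<forall>u\<in>A. f u = \<infinity>")
    case True
    then show ?thesis
      using assms MInf by (simp cong: INF_cong)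
  next
    case False
    then obtain u where u: "u \<in> A" "f u \<noteq> \<infinity>"
      by blast
    \<comment> \<open>The witness \<open>u\<close> makes the left side \<open>-\<infinity>\<close>
      and keeps the infimum of \<open>f\<close> below \<open>\<infinity>\<close>, so the right side
      is \<open>-\<infinity>\<close> too.\<close>
    have "(INF u\<in>A. f u + c) \<le> f u + c" "(INF u\<in>A. f u) \<le> f u"
      using u by (auto intro: INF_lower)
    then show ?thesis
      using u MInf by (cases "f u"; cases "INF u\<in>A. f u") auto
  qed
qed

text \<open>On a nonempty foreset \<open>cond_Inf g R v\<close> is the constant value of
  \<open>g\<close>; on an empty one both sides are \<open>\<infinity>\<close>.\<close>

lemma cond_Inf_add_const:
  assumes "g constant_on foreset R v"
  shows "cond_Inf (\<lambda>u. f u + g u) R v = cond_Inf f R v + cond_Inf g R v"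
proof (cases "foreset R v = {}")
  case True
  then show ?thesis
    by (simp add: cond_Inf_def top_ereal_def)
next
  case False
  from assms obtain c where c: "g u = c" if "u \<in> foreset R v" for u
    by (auto simp: constant_on_def)
  then show ?thesis
    using False by (simp add: cond_Inf_def INF_ereal_add_const c cong: INF_cong)
qed

lemma constant_on_iff_cond_argmin:
  "g constant_on foreset R v \<longleftrightarrow> cond_argmin g R v = foreset R v"
proof
  assume "g constant_on foreset R v"
  then obtain c where c: "g u = c" if "u \<in> foreset R v" for u
    by (auto simp: constant_on_def)
  have "g u = (INF u'\<in>foreset R v. g u')" if u: "u \<in> foreset R v" for u
  proof -
    have "(INF u'\<in>foreset R v. g u') = (INF u'\<in>foreset R v. c)"
      using c by (rule INF_cong[OF refl])
    also have "\<dots> = c"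
      using u by (intro INF_const) auto
    finally show ?thesis
      using c[OF u] by simp
  qed
  then show "cond_argmin g R v = foreset R v"
    unfolding cond_argmin_def by blast
next
  assume "cond_argmin g R v = foreset R v"
  then have "g u = (INF u\<in>foreset R v. g u)" if "u \<in> foreset R v" for u
    using that unfolding cond_argmin_def by blast
  then show "g constant_on foreset R v"
    unfolding constant_on_def by blast
qed

text \<open>Every value of \<open>g\<close> lies between the infimum and the supremum. The guard is
  there because on an empty foreset \<open>g\<close> is vacuously constant while these are
  \<open>\<infinity>\<close> and \<open>-\<infinity>\<close>.\<close>

lemma constant_on_iff_cond_Inf_eq_cond_Sup:
  "g constant_on foreset R v \<longleftrightarrow> (foreset R v \<noteq> {} \<longrightarrow> cond_Inf g R v = cond_Sup g R v)"
proof
  assume "g constant_on foreset R v"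
  then obtain c where "g u = c" if "u \<in> foreset R v" for u
    by (auto simp: constant_on_def)
  then show "foreset R v \<noteq> {} \<longrightarrow> cond_Inf g R v = cond_Sup g R v"
    by (simp add: cond_Inf_def cond_Sup_def cong: INF_cong SUP_cong)
next
  assume eq: "foreset R v \<noteq> {} \<longrightarrow> cond_Inf g R v = cond_Sup g R v"
  have "g u = cond_Inf g R v" if u: "u \<in> foreset R v" for u
  proof (rule antisym)
    show "cond_Inf g R v \<le> g u"
      using u by (simp add: cond_Inf_def INF_lower)
    have "g u \<le> cond_Sup g R v"
      using u by (simp add: cond_Sup_def SUP_upper)
    then show "g u \<le> cond_Inf g R v"
      using eq u by auto
  qed
  then show "g constant_on foreset R v"
    by (auto simp: constant_on_def)
qed

lemma cond_Inf_mono: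
  assumes "R \<subseteq> U \<times> V" and "\<forall>u\<in>U. f u \<le> g u"
  shows "cond_Inf f R v \<le> cond_Inf g R v"
  using assms by (fastforce simp: le_cond_Inf_iff intro: order.trans[OF cond_Inf_lower])

lemma INF_Image_le_cond_Inf: "v \<in> V \<Longrightarrow> (INF u\<in>R\<inverse> `` V. f u) \<le> cond_Inf f R v"
  by (auto simp: le_cond_Inf_iff intro: INF_lower)

lemma mono_cond_Inf_le: "mono \<phi> \<Longrightarrow> (\<phi> \<circ> cond_Inf f R) v \<le> cond_Inf (\<phi> \<circ> f) R v"
  by (auto simp: le_cond_Inf_iff intro!: monoD[of \<phi>] cond_Inf_lower)

lemma cond_Inf_antimono: "R \<subseteq> S \<Longrightarrow> cond_Inf f S v \<le> cond_Inf f R v"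
  by (auto simp: le_cond_Inf_iff intro: cond_Inf_lower)

lemma cond_Inf_UN: "cond_Inf f (\<Union>i\<in>I. R i) v = (INF i\<in>I. cond_Inf f (R i)) v"
  by (rule eq_by_lower_bounds) (auto simp: le_cond_Inf_iff le_INF_iff)

text \<open>The set \<open>S\<close> stands for \<open>U \<times> V\<close>, which is what the
  intersection of an empty family must be.\<close>

lemma SUP_cond_Inf_le_INT:
  "(SUP i\<in>I. cond_Inf f (R i)) v \<le> cond_Inf f (S \<inter> (\<Inter>i\<in>I. R i)) v"
  by (auto intro!: SUP_least cond_Inf_antimono)

lemma INF_cond_Inf: "(INF v\<in>A. cond_Inf f R v) = (INF u\<in>R\<inverse> `` A. f u)"
  by (rule eq_by_lower_bounds) (auto simp: le_cond_Inf_iff le_INF_iff)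

text \<open>On both sides a lower bound is one for \<open>f u\<close> over all chains from
  \<open>u\<close> through \<open>R\<close> and then \<open>S\<close> to \<open>w\<close>.\<close>

lemma cond_Inf_cond_Inf: "cond_Inf (cond_Inf f R) S w = cond_Inf f (R O S) w"
  by (rule eq_by_lower_bounds) (auto simp: le_cond_Inf_iff)

lemma cond_Inf_comp:
  assumes R: "R \<subseteq> U \<times> V" and \<theta>: "\<theta> \<in> U \<rightarrow> W"
  shows "cond_Inf (g \<circ> \<theta>) R v = cond_Inf g ((graph_on U W \<theta>)\<inverse> O R) v"
proof -
  have "(u, \<theta> u) \<in> graph_on U W \<theta>" if "(u, v) \<in> R" for u
    using R funcset_mem[OF \<theta>] that by (auto simp: graph_on_def)
  \<comment> \<open>Precomposing with the graph moves \<open>\<theta>\<close> from the function to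
    the index set of the infimum.\<close>
  then have "foreset ((graph_on U W \<theta>)\<inverse> O R) v = \<theta> ` foreset R v"
    by (auto simp: foreset_def graph_on_def)
  then show ?thesis
    by (simp add: cond_Inf_def image_comp)
qed

lemma cond_Inf_at_comp:
  assumes \<theta>: "\<theta> \<in> W \<rightarrow> V" and w: "w \<in> W"
  shows "(cond_Inf f R \<circ> \<theta>) w = cond_Inf f (R O (graph_on W V \<theta>)\<inverse>) w"
proof -
  have "\<theta> w \<in> V"
    using \<theta> w by (rule funcset_mem)
  \<comment> \<open>The only intermediate point related to \<open>w\<close> is
    \<open>\<theta> w\<close>.\<close>
  then have "foreset (R O (graph_on W V \<theta>)\<inverse>) w = foreset R (\<theta> w)"
    using w by (auto simp: foreset_def graph_on_def)
  then show ?thesis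
    by (simp add: cond_Inf_def)
qed

theorem proposition9:
  fixes U :: "'u set" and V :: "'v set" and W :: "'w set" and I :: "'i set"
  shows
    \<comment> \<open>nonnegativity\<close>
    "(\<forall>(f :: 'u \<Rightarrow> ereal). \<forall>R \<subseteq> U \<times> V.
        (\<forall>v\<in>V. cond_Inf f R v \<ge> 0) \<longleftrightarrow> (\<forall>u\<in>U. u \<in> Domain R \<longrightarrow> f u \<ge> 0)) \<and>
     \<comment> \<open>strict epigraph\<close>
     (\<forall>(f :: 'u \<Rightarrow> ereal). \<forall>R \<subseteq> U \<times> V.
        strict_epi V (cond_Inf f R) = R\<inverse> O strict_epi U f) \<and>
     \<comment> \<open>infima and suprema of families of functions\<close>
     (\<forall>R \<subseteq> U \<times> V. \<forall>(f :: 'i \<Rightarrow> 'u \<Rightarrow> ereal).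
        (\<forall>v\<in>V. cond_Inf (INF i\<in>I. f i) R v = (INF i\<in>I. cond_Inf (f i) R) v) \<and>
        (\<forall>v\<in>V. (SUP i\<in>I. cond_Inf (f i) R) v \<le> cond_Inf (SUP i\<in>I. f i) R v)) \<and>
     \<comment> \<open>upper addition; an empty foreset separates the last condition on g from the other two\<close>
     (\<forall>R \<subseteq> U \<times> V. \<forall>(f :: 'u \<Rightarrow> ereal) (g :: 'u \<Rightarrow> ereal).
        (\<forall>v\<in>V. cond_Inf (\<lambda>u. f u + g u) R v \<ge> cond_Inf f R v + cond_Inf g R v) \<and>
        ((\<forall>v\<in>V. g constant_on foreset R v) \<longleftrightarrow>
         (\<forall>v\<in>V. cond_argmin g R v = foreset R v)) \<and>
        ((\<forall>v\<in>V. g constant_on foreset R v) \<longleftrightarrow>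
         (\<forall>v\<in>V. foreset R v \<noteq> {} \<longrightarrow> cond_Inf g R v = cond_Sup g R v)) \<and>
        ((\<forall>v\<in>V. foreset R v \<noteq> {}) \<longrightarrow>
         ((\<forall>v\<in>V. g constant_on foreset R v) \<longleftrightarrow>
          (\<forall>v\<in>V. cond_Inf g R v = cond_Sup g R v))) \<and>
        ((\<forall>v\<in>V. g constant_on foreset R v) \<or>
         (\<forall>v\<in>V. cond_argmin g R v = foreset R v) \<or>
         (\<forall>v\<in>V. cond_Inf g R v = cond_Sup g R v) \<longrightarrow>
         (\<forall>v\<in>V. cond_Inf (\<lambda>u. f u + g u) R v = cond_Inf f R v + cond_Inf g R v))) \<and>
     \<comment> \<open>monotonicity in functions\<close>
     (\<forall>R \<subseteq> U \<times> V. \<forall>(f :: 'u \<Rightarrow> ereal) (g :: 'u \<Rightarrow> ereal).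
        ((\<forall>u\<in>U. f u \<le> g u) \<longrightarrow> (\<forall>v\<in>V. cond_Inf f R v \<le> cond_Inf g R v)) \<and>
        (INF u\<in>U. f u) \<le> (INF u\<in>R\<inverse> `` V. f u) \<and>
        (\<forall>v\<in>V. (INF u\<in>R\<inverse> `` V. f u) \<le> cond_Inf f R v) \<and>
        (\<forall>\<phi> :: ereal \<Rightarrow> ereal. mono \<phi> \<longrightarrow>
           (\<forall>v\<in>V. (\<phi> \<circ> cond_Inf f R) v \<le> cond_Inf (\<phi> \<circ> f) R v))) \<and>
     \<comment> \<open>monotonicity in correspondences\<close>
     (\<forall>R \<subseteq> U \<times> V. \<forall>S \<subseteq> U \<times> V. \<forall>(f :: 'u \<Rightarrow> ereal).
        R \<subseteq> S \<longrightarrow> (\<forall>v\<in>V. cond_Inf f R v \<ge> cond_Inf f S v)) \<and>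
     \<comment> \<open>families of correspondences; the empty intersection is \<open>U \<times> V\<close>\<close>
     (\<forall>(R :: 'i \<Rightarrow> ('u \<times> 'v) set) (f :: 'u \<Rightarrow> ereal).
        (\<forall>i\<in>I. R i \<subseteq> U \<times> V) \<longrightarrow>
        (\<forall>v\<in>V. cond_Inf f (\<Union>i\<in>I. R i) v = (INF i\<in>I. cond_Inf f (R i)) v) \<and>
        (\<forall>v\<in>V. cond_Inf f (U \<times> V \<inter> (\<Inter>i\<in>I. R i)) v \<ge> (SUP i\<in>I. cond_Inf f (R i)) v)) \<and>
     \<comment> \<open>pushforward\<close>
     (\<forall>R \<subseteq> U \<times> V. \<forall>A \<subseteq> V. \<forall>(f :: 'u \<Rightarrow> ereal).
        (INF v\<in>A. cond_Inf f R v) = (INF u\<in>R\<inverse> `` A. f u)) \<and>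
     \<comment> \<open>tower property\<close>
     (\<forall>R \<subseteq> U \<times> V. \<forall>S \<subseteq> V \<times> W. \<forall>(f :: 'u \<Rightarrow> ereal).
        \<forall>w\<in>W. cond_Inf (cond_Inf f R) S w = cond_Inf f (R O S) w) \<and>
     \<comment> \<open>right composition with mappings\<close>
     (\<forall>R \<subseteq> U \<times> V.
        (\<forall>(g :: 'w \<Rightarrow> ereal). \<forall>\<theta>\<in>U \<rightarrow> W.
           \<forall>v\<in>V. cond_Inf (g \<circ> \<theta>) R v = cond_Inf g ((graph_on U W \<theta>)\<inverse> O R) v) \<and>
        (\<forall>(f :: 'u \<Rightarrow> ereal). \<forall>\<theta>\<in>W \<rightarrow> V.
           \<forall>w\<in>W. (cond_Inf f R \<circ> \<theta>) w = cond_Inf f (R O (graph_on W V \<theta>)\<inverse>) w))"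
proof (intro conjI allI impI ballI)
  fix R :: "('u \<times> 'v) set" and f g :: "'u \<Rightarrow> ereal" and v
  assume "v \<in> V" and
    hyp: "(\<forall>v\<in>V. g constant_on foreset R v) \<or> (\<forall>v\<in>V. cond_argmin g R v = foreset R v) \<or>
      (\<forall>v\<in>V. cond_Inf g R v = cond_Sup g R v)"
  \<comment> \<open>The third alternative is the unguarded equality, which implies the guarded one
    characterizing constancy.\<close>
  then have "g constant_on foreset R v"
    using constant_on_iff_cond_argmin constant_on_iff_cond_Inf_eq_cond_Sup by metis
  then show "cond_Inf (\<lambda>u. f u + g u) R v = cond_Inf f R v + cond_Inf g R v"
    by (rule cond_Inf_add_const)
next
  fix R :: "('u \<times> 'v) set" and f :: "'u \<Rightarrow> ereal"
  assume "R \<subseteq> U \<times> V"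
  then show "(INF u\<in>U. f u) \<le> (INF u\<in>R\<inverse> `` V. f u)"
    by (intro INF_superset_mono) auto
next
  fix R :: "('u \<times> 'v) set" and g :: "'u \<Rightarrow> ereal"
  show "(\<forall>v\<in>V. g constant_on foreset R v) \<longleftrightarrow>
      (\<forall>v\<in>V. cond_argmin g R v = foreset R v)"
    by (simp only: constant_on_iff_cond_argmin)
  show "(\<forall>v\<in>V. g constant_on foreset R v) \<longleftrightarrow>
      (\<forall>v\<in>V. foreset R v \<noteq> {} \<longrightarrow> cond_Inf g R v = cond_Sup g R v)"
    by (simp only: constant_on_iff_cond_Inf_eq_cond_Sup)
  assume "\<forall>v\<in>V. foreset R v \<noteq> {}"
  then show "(\<forall>v\<in>V. g constant_on foreset R v) \<longleftrightarrow>
      (\<forall>v\<in>V. cond_Inf g R v = cond_Sup g R v)"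
    by (simp add: constant_on_iff_cond_Inf_eq_cond_Sup)
qed ((rule cond_Inf_nonneg_iff strict_epi_cond_Inf cond_Inf_INF SUP_cond_Inf_le cond_Inf_add_ge
    cond_Inf_mono INF_Image_le_cond_Inf mono_cond_Inf_le cond_Inf_antimono cond_Inf_UN
    SUP_cond_Inf_le_INT INF_cond_Inf cond_Inf_cond_Inf cond_Inf_comp cond_Inf_at_comp; assumption)+)

end
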